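(* Let $K$ be a field of characteristic zero and let $A = K\langle x,y\rangle/\langle xy-yx-x\rangle$. For integers $k \ge 1$ and $\ell \ge 0$ put $$w_{k,\ell} = (xy^{k}-y^{k}x)x^{\ell} \in A.$$ Then for all $k \ge 1$ and $\ell \ge 0$ the following relations hold in $A$: $$x\,w_{k,\ell} = \sum_{i=1}^{k} \binom{k}{i}\, w_{i,\ell+1},$$ $$y\,w_{k,\ell} = \frac{k}{k+1}\, w_{k+1,\ell} - \frac{1}{k+1}\sum_{i=1}^{k} \binom{k+1}{i} B_{k+1-i}\, w_{i,\ell}.$$
   Context: $K\langle x,y\rangle$ denotes the noncommutative polynomial ring (free associative unital $K$-algebra) in two indeterminates $x,y$, and $\langle xy-yx-x\rangle$ is the two-sided ideal generated by $xy-yx-x$. The images of $x,y$ in the quotient $A$ are again denoted $x,y$, so $xy-yx=x$ in $A$. The Bernoulli numbers $B_n \in \mathbb{Q}$ ($n\ge 0$) are defined recursively by $\sum_{i=0}^{n}\binom{n+1}{i}B_i = n+1$ for all $n\ge 0$ (so $B_0=1$, $B_1=+\tfrac12$, $B_2=\tfrac16$, ...), regarded as elements of $K$. *)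

theory Defs
  imports Complex_Main "HOL-Library.Poly_Mapping"
begin

section \<open>The free algebra on two indeterminates\<close>

text \<open>
  The free monoid is a copy of the list type, because the convolution product on
  \<open>'a \<Rightarrow>\<^sub>0 'b\<close> is taken with respect to an additively written monoid of exponents:
  \<open>+\<close> is concatenation of words and \<open>0\<close> is the empty word.
\<close>

datatype indet = Ind_x | Ind_y

datatype word = Word "indet list"

instantiation word :: monoid_add
begin

definition zero_word :: word where "0 = Word []"

fun plus_word :: "word \<Rightarrow> word \<Rightarrow> word" where
  "Word u + Word v = Word (u @ v)"

instance
proof
  fix a b c :: word
  show "a + b + c = a + (b + c)" by (cases a; cases b; cases c) simp
  show "0 + a = a" by (cases a) (simp add: zero_word_def)
  show "a + 0 = a" by (cases a) (simp add: zero_word_def)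
qed

end

lemma zero_eq_plus_word_iff: "(0 :: word) = u + v \<longleftrightarrow> u = 0 \<and> v = 0"
  by (cases u; cases v) (auto simp: zero_word_def)

type_synonym 'k free_alg = "word \<Rightarrow>\<^sub>0 'k"

definition free_x :: "'k::field free_alg" where
  "free_x = Poly_Mapping.single (Word [Ind_x]) 1"

definition free_y :: "'k::field free_alg" where
  "free_y = Poly_Mapping.single (Word [Ind_y]) 1"

definition free_const :: "'k::field \<Rightarrow> 'k free_alg" where
  "free_const c = Poly_Mapping.single 0 c"

lemma lookup_mult_zero_word:
  fixes p q :: "'k::field free_alg"
  shows "Poly_Mapping.lookup (p * q) 0 = Poly_Mapping.lookup p 0 * Poly_Mapping.lookup q 0"
proof -
  have "Poly_Mapping.lookup (p * q) 0 =
      (\<Sum>l. Poly_Mapping.lookup p l * (\<Sum>r. Poly_Mapping.lookup q r when 0 = l + r))"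
    by (simp add: lookup_mult)
  also have "\<dots> = (\<Sum>l. Poly_Mapping.lookup p l * Poly_Mapping.lookup q 0 when l = 0)"
  proof (intro Sum_any.cong)
    fix l
    show "Poly_Mapping.lookup p l * (\<Sum>r. Poly_Mapping.lookup q r when 0 = l + r) =
        (Poly_Mapping.lookup p l * Poly_Mapping.lookup q 0 when l = 0)"
      by (cases "l = 0") (simp_all add: zero_eq_plus_word_iff)
  qed
  finally show ?thesis by simp
qed

lemma free_const_commute: "free_const c * p = p * free_const c"
proof (induction p rule: Poly_Mapping.update_induct)
  case const
  show ?case by simp
next
  case (update f a b)
  have "Poly_Mapping.update a b f = Poly_Mapping.single a b + f"
    using update.hyps(1)
    by (intro poly_mapping_eqI)
      (auto simp: lookup_update lookup_add lookup_single when_def in_keys_iff)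
  moreover have "free_const c * Poly_Mapping.single a b = Poly_Mapping.single a b * free_const c"
    by (simp add: free_const_def mult_single mult.commute)
  ultimately show ?case
    using update.IH by (simp add: distrib_left distrib_right)
qed


section \<open>Two-sided ideals\<close>

text \<open>Closure under negation follows from closure under multiplication by \<open>- 1\<close>.\<close>

definition two_sided_ideal :: "'a::ring_1 set \<Rightarrow> bool" where
  "two_sided_ideal I \<longleftrightarrow>
     0 \<in> I \<and> (\<forall>a\<in>I. \<forall>b\<in>I. a + b \<in> I) \<and> (\<forall>a\<in>I. \<forall>r. r * a \<in> I \<and> a * r \<in> I)"

definition ideal_generated :: "'a::ring_1 set \<Rightarrow> 'a set" where
  "ideal_generated S = \<Inter>{I. two_sided_ideal I \<and> S \<subseteq> I}"

lemma two_sided_ideal_ideal_generated: "two_sided_ideal (ideal_generated S)"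
  unfolding ideal_generated_def two_sided_ideal_def by blast

lemma ideal_generated_superset: "S \<subseteq> ideal_generated S"
  unfolding ideal_generated_def by blast

lemma ideal_generated_least: "two_sided_ideal I \<Longrightarrow> S \<subseteq> I \<Longrightarrow> ideal_generated S \<subseteq> I"
  unfolding ideal_generated_def by blast

lemma two_sided_ideal_diff:
  fixes I :: "'a::ring_1 set"
  assumes "two_sided_ideal I" "a \<in> I" "b \<in> I"
  shows "a - b \<in> I"
proof -
  have "(- 1) * b \<in> I" using assms unfolding two_sided_ideal_def by blast
  then have "a + (- 1) * b \<in> I" using assms unfolding two_sided_ideal_def by blast
  then show ?thesis by simp
qed


section \<open>The quotient algebra\<close>

definition rel_ideal :: "'k::field free_alg set" where
  "rel_ideal = ideal_generated {free_x * free_y - free_y * free_x - free_x}"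

lemma two_sided_ideal_rel_ideal: "two_sided_ideal (rel_ideal :: 'k::field free_alg set)"
  unfolding rel_ideal_def by (rule two_sided_ideal_ideal_generated)

lemma
  fixes a b r :: "'k::field free_alg"
  shows rel_ideal_zero: "(0 :: 'k free_alg) \<in> rel_ideal"
    and rel_ideal_add: "a \<in> rel_ideal \<Longrightarrow> b \<in> rel_ideal \<Longrightarrow> a + b \<in> rel_ideal"
    and rel_ideal_mult_left: "a \<in> rel_ideal \<Longrightarrow> r * a \<in> rel_ideal"
    and rel_ideal_mult_right: "a \<in> rel_ideal \<Longrightarrow> a * r \<in> rel_ideal"
  using two_sided_ideal_rel_ideal[where 'k = 'k] unfolding two_sided_ideal_def by blast+

lemma rel_ideal_diff:
  fixes a b :: "'k::field free_alg"
  shows "a \<in> rel_ideal \<Longrightarrow> b \<in> rel_ideal \<Longrightarrow> a - b \<in> rel_ideal"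
  by (rule two_sided_ideal_diff[OF two_sided_ideal_rel_ideal])

lemma one_notin_rel_ideal: "(1 :: 'k::field free_alg) \<notin> rel_ideal"
proof -
  let ?I = "{p :: 'k free_alg. Poly_Mapping.lookup p 0 = 0}"
  have "two_sided_ideal ?I"
    unfolding two_sided_ideal_def by (auto simp: lookup_mult_zero_word lookup_add)
  moreover have "{free_x * free_y - free_y * free_x - free_x} \<subseteq> ?I"
    by (auto simp: lookup_mult_zero_word lookup_minus free_x_def free_y_def
        lookup_single mult_single zero_word_def when_def)
  ultimately have "rel_ideal \<subseteq> ?I"
    unfolding rel_ideal_def by (rule ideal_generated_least)
  then show ?thesis by (auto simp: lookup_one)
qed

definition alg_rel :: "'k::field free_alg \<Rightarrow> 'k free_alg \<Rightarrow> bool" where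
  "alg_rel p q \<longleftrightarrow> p - q \<in> rel_ideal"

lemma equivp_alg_rel: "equivp (alg_rel :: 'k::field free_alg \<Rightarrow> _)"
proof (rule equivpI)
  show "reflp (alg_rel :: 'k free_alg \<Rightarrow> _)"
    by (simp add: reflp_def alg_rel_def rel_ideal_zero)
  show "symp (alg_rel :: 'k free_alg \<Rightarrow> _)"
    by (rule sympI) (use rel_ideal_diff[OF rel_ideal_zero] in \<open>force simp: alg_rel_def\<close>)
  show "transp (alg_rel :: 'k free_alg \<Rightarrow> _)"
    by (rule transpI) (use rel_ideal_add in \<open>force simp: alg_rel_def\<close>)
qed

quotient_type (overloaded) 'k alg = "'k::field free_alg" / alg_rel
  by (rule equivp_alg_rel)

instantiation alg :: (field) ring_1
begin

lift_definition zero_alg :: "'a alg" is 0 .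
lift_definition one_alg :: "'a alg" is 1 .

lift_definition plus_alg :: "'a alg \<Rightarrow> 'a alg \<Rightarrow> 'a alg" is "(+)"
  unfolding alg_rel_def by (metis rel_ideal_add add_diff_add)

lift_definition uminus_alg :: "'a alg \<Rightarrow> 'a alg" is uminus
  unfolding alg_rel_def by (metis rel_ideal_diff rel_ideal_zero diff_0 minus_diff_minus)

lift_definition minus_alg :: "'a alg \<Rightarrow> 'a alg \<Rightarrow> 'a alg" is "(-)"
  unfolding alg_rel_def by (metis rel_ideal_diff diff_diff_eq2 diff_add_eq diff_diff_add add.commute)

lift_definition times_alg :: "'a alg \<Rightarrow> 'a alg \<Rightarrow> 'a alg" is "(*)"
proof -
  fix a b c d :: "'a free_alg"
  assume "alg_rel a b" "alg_rel c d"
  then have "(a - b) * c + b * (c - d) \<in> rel_ideal"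
    unfolding alg_rel_def by (intro rel_ideal_add rel_ideal_mult_left rel_ideal_mult_right)
  then show "alg_rel (a * c) (b * d)"
    by (simp add: alg_rel_def algebra_simps)
qed

instance
proof
  have refl: "alg_rel p p" for p :: "'a free_alg"
    by (simp add: alg_rel_def rel_ideal_zero)
  fix a b c :: "'a alg"
  show "a + b + c = a + (b + c)" by transfer (simp add: add.assoc refl)
  show "a + b = b + a" by transfer (simp add: add.commute refl)
  show "0 + a = a" by transfer (simp add: refl)
  show "- a + a = 0" by transfer (simp add: refl)
  show "a - b = a + - b" by transfer (simp add: refl)
  show "a * b * c = a * (b * c)" by transfer (simp add: mult.assoc refl)
  show "1 * a = a" by transfer (simp add: refl)
  show "a * 1 = a" by transfer (simp add: refl)
  show "(a + b) * c = a * c + b * c" by transfer (simp add: distrib_right refl)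
  show "a * (b + c) = a * b + a * c" by transfer (simp add: distrib_left refl)
  show "(0 :: 'a alg) \<noteq> 1"
  proof transfer
    have "(1 :: 'a free_alg) \<in> rel_ideal" if "alg_rel (0 :: 'a free_alg) 1"
      using rel_ideal_diff[OF rel_ideal_zero that[unfolded alg_rel_def]] by simp
    then show "\<not> alg_rel (0 :: 'a free_alg) 1" using one_notin_rel_ideal by blast
  qed
qed

end

lift_definition alg_x :: "'k::field alg" is free_x .
lift_definition alg_y :: "'k::field alg" is free_y .

lift_definition alg_scale :: "'k::field \<Rightarrow> 'k alg \<Rightarrow> 'k alg" (infixr \<open>*\<^sub>K\<close> 75)
  is "\<lambda>c p. free_const c * p"
  by (simp add: alg_rel_def rel_ideal_mult_left flip: right_diff_distrib)

lemma alg_relation: "alg_x * alg_y - alg_y * alg_x = alg_x"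
  by transfer (use ideal_generated_superset in \<open>force simp: alg_rel_def rel_ideal_def\<close>)

lemma alg_scale_mult_left: "(c *\<^sub>K a) * b = c *\<^sub>K (a * b)"
  by transfer (simp add: alg_rel_def rel_ideal_zero mult.assoc)

lemma alg_scale_mult_right: "a * (c *\<^sub>K b) = c *\<^sub>K (a * b)"
proof transfer
  fix a b :: "'k::field free_alg" and c :: 'k
  have "a * (free_const c * b) = free_const c * (a * b)"
    by (metis free_const_commute mult.assoc)
  then show "alg_rel (a * (free_const c * b)) (free_const c * (a * b))"
    by (simp add: alg_rel_def rel_ideal_zero)
qed

global_interpretation alg: vector_space "alg_scale :: 'k::field \<Rightarrow> _"
proof
  fix a b :: 'k and u v :: "'k alg"
  show "a *\<^sub>K (u + v) = a *\<^sub>K u + a *\<^sub>K v"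
    by transfer (simp add: alg_rel_def rel_ideal_zero distrib_left)
  show "(a + b) *\<^sub>K u = a *\<^sub>K u + b *\<^sub>K u"
    by transfer (simp add: alg_rel_def rel_ideal_zero distrib_right free_const_def single_add)
  show "a *\<^sub>K b *\<^sub>K u = (a * b) *\<^sub>K u"
    by transfer (simp add: alg_rel_def rel_ideal_zero free_const_def mult_single flip: mult.assoc)
  show "1 *\<^sub>K u = u"
    by transfer (simp add: alg_rel_def rel_ideal_zero free_const_def)
qed

definition w :: "nat \<Rightarrow> nat \<Rightarrow> 'k::field alg" where
  "w k l = (alg_x * alg_y ^ k - alg_y ^ k * alg_x) * alg_x ^ l"


section \<open>Bernoulli numbers\<close>

text \<open>
  The defining recursion solved for its term of highest index, whose coefficient is \<open>n + 1\<close>;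
  see \<open>bernoulli_recursion\<close>. The convention is \<open>B\<^sub>1 = + 1/2\<close>.
\<close>

fun bernoulli :: "nat \<Rightarrow> rat" where
  "bernoulli n =
     (of_nat (n + 1) - (\<Sum>i<n. of_nat ((n + 1) choose i) * bernoulli i)) / of_nat (n + 1)"

declare bernoulli.simps [simp del]

lemma bernoulli_recursion:
  "(\<Sum>i=0..n. of_nat ((n + 1) choose i) * bernoulli i) = of_nat (n + 1)"
proof -
  have "(\<Sum>i=0..n. of_nat ((n + 1) choose i) * bernoulli i) =
      (\<Sum>i<n. of_nat ((n + 1) choose i) * bernoulli i) + of_nat (n + 1) * bernoulli n"
    by (simp add: atLeast0AtMost flip: lessThan_Suc_atMost)
  then show ?thesis
    by (subst (asm) (2) bernoulli.simps) (simp del: of_nat_Suc)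
qed

end

theory Submission
  imports Defs
begin

text \<open>
  The relation says \<open>x y = (y + 1) x\<close>, so \<open>w\<^sub>k\<^sub>,\<^sub>l = ((y + 1)\<^sup>k - y\<^sup>k) x\<^sup>l\<^sup>+\<^sup>1\<close> and both
  identities reduce to identities between polynomials in the single indeterminate \<open>y\<close>.
  The first is the binomial theorem at \<open>y + 2\<close> and \<open>y + 1\<close>. The second is the difference
  equation \<open>B\<^sub>n(y + 1) - B\<^sub>n(y) = n (y + 1)\<^sup>n\<^sup>-\<^sup>1\<close> of the Bernoulli polynomials (for \<open>B\<^sub>1 = 1/2\<close>)
  with \<open>n = k + 1\<close>, whose term of index \<open>i = n\<close> is split off from the sum.
\<close>

text \<open>\<open>a\<close> and 1 commute, so Pascal's rule proves the expansion even when
  multiplication is noncommutative, as in \<open>alg\<close>.\<close>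

lemma binomial_add_one:
  fixes a :: "'a::semiring_1"
  shows "(a + 1) ^ n = (\<Sum>j\<le>n. of_nat (n choose j) * a ^ j)"
proof (induction n)
  case (Suc n)
  \<comment> \<open>After the index shift the top term carries \<open>n choose Suc n = 0\<close>, so
    both sums may run up to \<open>n\<close>.\<close>
  have shift: "1 + (\<Sum>j\<le>n. of_nat (n choose Suc j) * a ^ Suc j) =
      (\<Sum>j\<le>n. of_nat (n choose j) * a ^ j)"
    using sum.atMost_Suc_shift[of "\<lambda>j. of_nat (n choose j) * a ^ j" n]
    by (simp add: binomial_eq_0 del: power_Suc)
  have "(\<Sum>j\<le>Suc n. of_nat (Suc n choose j) * a ^ j) =
      (\<Sum>j\<le>n. of_nat (n choose j) * a ^ Suc j)
        + (1 + (\<Sum>j\<le>n. of_nat (n choose Suc j) * a ^ Suc j))"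
    by (subst sum.atMost_Suc_shift)
      (simp add: distrib_right sum.distrib add.left_commute del: power_Suc)
  also have "\<dots> = (a + 1) ^ n * (a + 1)"
    by (simp only: shift) (simp add: Suc.IH distrib_left sum_distrib_right mult.assoc power_commutes)
  finally show ?case by (simp add: power_commutes)
qed simp

lemma of_nat_alg_scale: "of_nat n *\<^sub>K a = of_nat n * (a :: 'k::field alg)"
  by (induction n) (simp_all add: alg.scale_left_distrib distrib_right)

text \<open>The recursion at \<open>n - 1\<close>, transported from the rationals to
  \<open>'k\<close>; for \<open>n = 0\<close> both sides vanish.\<close>

lemma of_rat_bernoulli_sum:
  "(\<Sum>m<n. of_nat (n choose m) * of_rat (bernoulli m)) = (of_nat n :: 'k::field_char_0)"
proof (cases n)
  case (Suc n')
  have "(\<Sum>m<n. of_nat (n choose m) * of_rat (bernoulli m)) =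
      (of_rat (\<Sum>m<n. of_nat (n choose m) * bernoulli m) :: 'k)"
    by (simp add: of_rat_sum of_rat_mult)
  also have "(\<Sum>m<n. of_nat (n choose m) * bernoulli m) = of_nat n"
    using bernoulli_recursion[of n'] by (simp only: Suc Suc_eq_plus1 atLeast0AtMost
        flip: lessThan_Suc_atMost)
  finally show ?thesis by simp
qed simp

text \<open>This is the coefficient of \<open>a ^ j\<close> in the difference equation. Since
  \<open>(n choose i) * (i choose j) = (n choose j) * ((n - j) choose (i - j))\<close>, the
  substitution \<open>m = n - i\<close> leaves the Bernoulli recursion for \<open>n - j\<close>;
  absorption then rewrites \<open>(n - j) * (n choose j)\<close>.\<close>

lemma bernoulli_binomial_sum:
  assumes "j < n"
  shows "(\<Sum>i\<in>{j<..n}. of_nat (n choose i) * of_rat (bernoulli (n - i)) * of_nat (i choose j)) =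
    (of_nat n * of_nat ((n - 1) choose j) :: 'k::field_char_0)"
proof -
  have "(\<Sum>i\<in>{j<..n}. of_nat (n choose i) * of_rat (bernoulli (n - i)) * of_nat (i choose j)) =
      (\<Sum>m<n - j. of_nat (n choose j) * (of_nat ((n - j) choose m) * of_rat (bernoulli m)) :: 'k)"
  proof (rule sum.reindex_bij_witness[of _ "\<lambda>m. n - m" "\<lambda>i. n - i"])
    fix i assume i: "i \<in> {j<..n}"
    then have "(n choose i) * (i choose j) = (n choose j) * ((n - j) choose (i - j))"
      by (intro choose_mult) auto
    also have "(n - j) choose (i - j) = (n - j) choose (n - i)"
      using i by (subst binomial_symmetric) auto
    finally have "(of_nat (n choose i) * of_nat (i choose j) :: 'k) =
        of_nat (n choose j) * of_nat ((n - j) choose (n - i))"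
      by (simp flip: of_nat_mult)
    then show "of_nat (n choose j) * (of_nat ((n - j) choose (n - i)) * of_rat (bernoulli (n - i))) =
        (of_nat (n choose i) * of_rat (bernoulli (n - i)) * of_nat (i choose j) :: 'k)"
      by (simp add: mult_ac)
  qed (use assms in auto)
  also have "\<dots> = of_nat ((n - j) * (n choose j))"
    by (simp add: of_rat_bernoulli_sum flip: sum_distrib_left)
  also have "(n - j) * (n choose j) = n * ((n - 1) choose j)"
    using binomial_absorb_comp[of n j] .
  finally show ?thesis by simp
qed

text \<open>Expanding the differences in powers of \<open>a\<close> and swapping the two sums leaves
  the coefficients \<open>n * ((n - 1) choose j)\<close>, which the binomial theorem reassembles.
  The constant term of the Bernoulli polynomial cancels, so \<open>i\<close> starts at 1.\<close>

lemma bernoulli_difference: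
  fixes a :: "'k::field_char_0 alg"
  shows "(\<Sum>i=1..n. (of_nat (n choose i) * of_rat (bernoulli (n - i))) *\<^sub>K ((a + 1) ^ i - a ^ i)) =
    of_nat n *\<^sub>K (a + 1) ^ (n - 1)"
proof -
  let ?c = "\<lambda>i j. of_nat (n choose i) * of_rat (bernoulli (n - i)) * of_nat (i choose j) :: 'k"
  have diff: "(a + 1) ^ i - a ^ i = (\<Sum>j<i. of_nat (i choose j) *\<^sub>K a ^ j)" for i
    by (simp add: binomial_add_one of_nat_alg_scale flip: lessThan_Suc_atMost)
  have "(\<Sum>i=1..n. (of_nat (n choose i) * of_rat (bernoulli (n - i))) *\<^sub>K ((a + 1) ^ i - a ^ i)) =
      (\<Sum>i=1..n. \<Sum>j\<in>{j \<in> {..<n}. j < i}. ?c i j *\<^sub>K a ^ j)"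
    by (intro sum.cong refl) (auto simp: diff alg.scale_sum_right intro!: sum.cong)
  also have "\<dots> = (\<Sum>j<n. \<Sum>i\<in>{i \<in> {1..n}. j < i}. ?c i j *\<^sub>K a ^ j)"
    by (rule sum.swap_restrict) auto
  also have "\<dots> = (\<Sum>j<n. (\<Sum>i\<in>{j<..n}. ?c i j) *\<^sub>K a ^ j)"
    unfolding alg.scale_sum_left by (intro sum.cong refl) auto
  also have "\<dots> = of_nat n *\<^sub>K (\<Sum>j<n. of_nat ((n - 1) choose j) *\<^sub>K a ^ j)"
    by (simp add: bernoulli_binomial_sum alg.scale_sum_right)
  also have "\<dots> = of_nat n *\<^sub>K (a + 1) ^ (n - 1)"
    by (cases n) (simp_all add: binomial_add_one of_nat_alg_scale lessThan_Suc_atMost)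
  finally show ?thesis .
qed

lemma alg_x_mult_alg_y: "alg_x * alg_y = (alg_y + 1) * (alg_x :: 'k::field alg)"
  using alg_relation[where 'a = 'k] by (simp add: algebra_simps)

lemma mult_power_eq_power_mult:
  fixes x a b :: "'a::monoid_mult"
  assumes "x * a = b * x"
  shows "x * a ^ n = b ^ n * x"
proof (induction n)
  case (Suc n)
  have "x * a ^ Suc n = b * (x * a ^ n)"
    by (simp add: assms flip: mult.assoc)
  then show ?case by (simp add: Suc.IH mult.assoc)
qed simp

lemma w_eq: "w k l = ((alg_y + 1) ^ k - alg_y ^ k) * (alg_x :: 'k::field alg) ^ (l + 1)"
  by (simp add: w_def mult_power_eq_power_mult[OF alg_x_mult_alg_y] mult.assoc flip: left_diff_distrib)

lemma alg_x_mult_w: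
  "alg_x * (w k l :: 'k::field alg) = (\<Sum>i=1..k. of_nat (k choose i) *\<^sub>K w i (l + 1))"
proof -
  let ?y = "alg_y :: 'k alg" and ?x = "alg_x :: 'k alg"
  \<comment> \<open>Passing \<open>?x\<close> to the right shifts \<open>?y\<close> by one, hence
    also takes \<open>?y + 1\<close> to \<open>?y + 2\<close>.\<close>
  have xy1: "?x * (?y + 1) = (?y + 1 + 1) * ?x"
    by (simp add: distrib_left distrib_right alg_x_mult_alg_y)
  have "?x * w k l = (?x * ((?y + 1) ^ k - ?y ^ k)) * ?x ^ (l + 1)"
    by (simp add: w_eq mult.assoc)
  also have "?x * ((?y + 1) ^ k - ?y ^ k) = ((?y + 1 + 1) ^ k - (?y + 1) ^ k) * ?x"
    by (simp only: right_diff_distrib left_diff_distrib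
        mult_power_eq_power_mult[OF xy1] mult_power_eq_power_mult[OF alg_x_mult_alg_y])
  also have "(?y + 1 + 1) ^ k - (?y + 1) ^ k =
      (\<Sum>i\<le>k. of_nat (k choose i) * ((?y + 1) ^ i - ?y ^ i))"
    by (simp only: binomial_add_one[of "?y + 1"] binomial_add_one[of ?y k]
        right_diff_distrib sum_subtractf)
  \<comment> \<open>The term \<open>i = 0\<close> is zero because both powers are 1.\<close>
  also have "\<dots> = (\<Sum>i=1..k. of_nat (k choose i) * ((?y + 1) ^ i - ?y ^ i))"
    by (rule sum.mono_neutral_right) (auto simp: not_less_eq_eq)
  finally show ?thesis
    by (simp add: w_eq of_nat_alg_scale sum_distrib_right mult.assoc)
qed

lemma alg_y_mult_w:
  "alg_y * (w k l :: 'k::field_char_0 alg) =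
     (of_nat k / of_nat (k + 1)) *\<^sub>K w (k + 1) l
     - (1 / of_nat (k + 1)) *\<^sub>K
         (\<Sum>i=1..k. (of_nat ((k + 1) choose i) * of_rat (bernoulli (k + 1 - i))) *\<^sub>K w i l)"
proof -
  let ?y = "alg_y :: 'k alg" and ?z = "(alg_x :: 'k alg) ^ (l + 1)" and ?K = "of_nat (k + 1) :: 'k"
  let ?S = "\<Sum>i=1..k. (of_nat ((k + 1) choose i) * of_rat (bernoulli (k + 1 - i))) *\<^sub>K (w i l :: 'k alg)"
  have K: "?K \<noteq> 0" by (simp del: of_nat_Suc)
  \<comment> \<open>This value makes \<open>w (k + 1) l\<close> exactly the term
    \<open>i = k + 1\<close> that completes \<open>?S\<close> to the full Bernoulli sum.\<close>
  have "bernoulli 0 = 1" by (subst bernoulli.simps) simp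
  then have "?S + w (k + 1) l =
      (\<Sum>i=1..k + 1. (of_nat ((k + 1) choose i) * of_rat (bernoulli (k + 1 - i))) *\<^sub>K
         ((?y + 1) ^ i - ?y ^ i)) * ?z"
    by (simp add: w_eq sum_distrib_right alg_scale_mult_left distrib_right)
  then have "?S = ?K *\<^sub>K ((?y + 1) ^ k * ?z) - w (k + 1) l"
    by (simp only: bernoulli_difference alg_scale_mult_left eq_diff_eq) simp
  then have "(of_nat k / ?K) *\<^sub>K w (k + 1) l - (1 / ?K) *\<^sub>K ?S =
      (of_nat k / ?K + 1 / ?K) *\<^sub>K w (k + 1) l - (?y + 1) ^ k * ?z"
    using K by (simp add: alg.scale_right_diff_distrib alg.scale_left_distrib del: of_nat_Suc of_nat_add)
  also have "of_nat k / ?K + 1 / ?K = 1"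
    using K by (simp add: add.commute flip: add_divide_distrib)
  \<comment> \<open>Here
    \<open>(?y + 1) ^ (k + 1) - (?y + 1) ^ k = ?y * (?y + 1) ^ k\<close>.\<close>
  also have "1 *\<^sub>K w (k + 1) l - (?y + 1) ^ k * ?z = ?y * w k l"
    by (simp add: w_eq algebra_simps)
  finally show ?thesis ..
qed

theorem theorem3p2:
  fixes k l :: nat
  assumes "k \<ge> 1"
  shows "alg_x * (w k l :: 'k::field_char_0 alg) =
           (\<Sum>i=1..k. of_nat (k choose i) *\<^sub>K w i (l + 1))
       \<and> alg_y * (w k l :: 'k alg) =
           (of_nat k / of_nat (k + 1)) *\<^sub>K w (k + 1) l
           - (1 / of_nat (k + 1)) *\<^sub>K
               (\<Sum>i=1..k. (of_nat ((k + 1) choose i) * of_rat (bernoulli (k + 1 - i))) *\<^sub>K w i l)"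
  by (intro conjI alg_x_mult_w alg_y_mult_w)

end
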